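(* Let $G$ and $K$ be groups and let $\phi: G \to K$ be a surjective homomorphism whose kernel is central (contained in the center of $G$). The following are equivalent. (1) The homomorphism $\phi$ is centralizer-respecting. (2) The kernel of $\phi$ does not contain any nontrivial commutators, i.e. elements of the form $[x,y] \neq 1$ with $x,y \in G$. Moreover, if such a homomorphism $\phi$ is centralizer-respecting, then the induced map $\mathcal{C}_\phi : \mathcal{C}(G) \to \mathcal{C}(K)$ is an isomorphism of centralizer lattices.
   Context: For a group $G$ and a subset $X \subseteq G$, $\mathbf{C}_G(X) = \{g \in G : xg = gx \text{ for all } x \in X\}$ is the centralizer of $X$ in $G$. $[x,y]$ denotes the group commutator of the two elements $x,y$. A surjective group homomorphism $\phi: G \to K$ is centralizer-respecting if $\phi(\mathbf{C}_G(A)) = \mathbf{C}_K(\phi(A))$ for every subgroup $A \leq G$. The centralizer lattice $\mathcal{C}(G)$ of a group $G$ is the poset (under inclusion) of all subgroups of $G$ of the form $\mathbf{C}_G(X)$ for some $X \subseteq G$, together with the meet $\mathbf{C}_G(X) \wedge_{\mathbf{C}} \mathbf{C}_G(Y) = \mathbf{C}_G(\langle X, Y\rangle)$ (which equals $\mathbf{C}_G(X) \cap \mathbf{C}_G(Y)$), the join $\mathbf{C}_G(X) \vee_{\mathbf{C}} \mathbf{C}_G(Y) = \mathbf{C}_G\big(\mathbf{C}_G(\mathbf{C}_G(X)) \wedge_{\mathbf{C}} \mathbf{C}_G(\mathbf{C}_G(Y))\big)$ (the smallest centralizer in $G$ containing both $\mathbf{C}_G(X)$ and $\mathbf{C}_G(Y)$),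 and the involution $\mathbf{C}_G(\cdot)$. A centralizer lattice homomorphism $f: \mathcal{C}(G) \to \mathcal{C}(K)$ is a map preserving $\wedge_{\mathbf{C}}$ and $\vee_{\mathbf{C}}$ and respecting the centralizer involution, i.e. $f(\mathbf{C}_G(\mathbf{C}_G(X))) = \mathbf{C}_K(f(\mathbf{C}_G(X)))$ for all $X \leq G$. An isomorphism of centralizer lattices is a bijective centralizer lattice homomorphism. For a centralizer-respecting homomorphism $\phi: G \to K$, the induced map $\mathcal{C}_\phi$ on $\mathcal{C}(G)$ is given by $\mathcal{C}_\phi(\mathbf{C}_G(X)) = \mathbf{C}_K(\phi(X)) = \phi(\mathbf{C}_G(X))$. *)

theory Defs
  imports "HOL-Algebra.Generated_Groups"
begin

definition centralizer :: "('a, 'm) monoid_scheme \<Rightarrow> 'a set \<Rightarrow> 'a set" where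
  "centralizer G X = {g \<in> carrier G. \<forall>x\<in>X. x \<otimes>\<^bsub>G\<^esub> g = g \<otimes>\<^bsub>G\<^esub> x}"

definition center :: "('a, 'm) monoid_scheme \<Rightarrow> 'a set" where
  "center G = centralizer G (carrier G)"

(* Same convention as derived_set. The other common one, inv x * inv y * x * y, is
   commutator G (inv x) (inv y), so the set of all commutators does not depend on it. *)
definition commutator :: "('a, 'm) monoid_scheme \<Rightarrow> 'a \<Rightarrow> 'a \<Rightarrow> 'a" where
  "commutator G x y = x \<otimes>\<^bsub>G\<^esub> y \<otimes>\<^bsub>G\<^esub> inv\<^bsub>G\<^esub> x \<otimes>\<^bsub>G\<^esub> inv\<^bsub>G\<^esub> y"

definition centralizer_respecting ::
    "('a, 'm) monoid_scheme \<Rightarrow> ('b, 'n) monoid_scheme \<Rightarrow> ('a \<Rightarrow> 'b) \<Rightarrow> bool" where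
  "centralizer_respecting G K \<phi> \<longleftrightarrow>
     \<phi> \<in> epi G K \<and>
     (\<forall>A. subgroup A G \<longrightarrow> \<phi> ` centralizer G A = centralizer K (\<phi> ` A))"

definition centralizer_lattice :: "('a, 'm) monoid_scheme \<Rightarrow> 'a set set" where
  "centralizer_lattice G = {centralizer G X | X. X \<subseteq> carrier G}"

(* Meet and join take centralizers, not generating sets, as arguments, so that they are well
   defined; the lemma meet_centralizer below gives the formula in terms of generating sets. *)
definition centralizer_meet :: "'a set \<Rightarrow> 'a set \<Rightarrow> 'a set" where
  "centralizer_meet A B = A \<inter> B"

definition centralizer_join :: "('a, 'm) monoid_scheme \<Rightarrow> 'a set \<Rightarrow> 'a set \<Rightarrow> 'a set" where
  "centralizer_join G A B =
     centralizer G (centralizer_meet (centralizer G A) (centralizer G B))"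

definition centralizer_lattice_hom ::
    "('a, 'm) monoid_scheme \<Rightarrow> ('b, 'n) monoid_scheme \<Rightarrow> ('a set \<Rightarrow> 'b set) \<Rightarrow> bool" where
  "centralizer_lattice_hom G K f \<longleftrightarrow>
     f \<in> centralizer_lattice G \<rightarrow> centralizer_lattice K \<and>
     (\<forall>A\<in>centralizer_lattice G. \<forall>B\<in>centralizer_lattice G.
        f (centralizer_meet A B) = centralizer_meet (f A) (f B)) \<and>
     (\<forall>A\<in>centralizer_lattice G. \<forall>B\<in>centralizer_lattice G.
        f (centralizer_join G A B) = centralizer_join K (f A) (f B)) \<and>
     (\<forall>X. subgroup X G \<longrightarrow>
        f (centralizer G (centralizer G X)) = centralizer K (f (centralizer G X)))"

definition centralizer_lattice_iso ::
    "('a, 'm) monoid_scheme \<Rightarrow> ('b, 'n) monoid_scheme \<Rightarrow> ('a set \<Rightarrow> 'b set) \<Rightarrow> bool" where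
  "centralizer_lattice_iso G K f \<longleftrightarrow>
     centralizer_lattice_hom G K f \<and>
     bij_betw f (centralizer_lattice G) (centralizer_lattice K)"

(* The other description of the induced map, sending the centralizer of X to the centralizer of
   the image of X, is the lemma induced_map_centralizer below. *)
definition induced_map :: "('a, 'm) monoid_scheme \<Rightarrow> ('a \<Rightarrow> 'b) \<Rightarrow> 'a set \<Rightarrow> 'b set" where
  "induced_map G \<phi> = (\<lambda>C\<in>centralizer_lattice G. \<phi> ` C)"

lemma (in group) subgroup_centralizer:
  assumes "X \<subseteq> carrier G"
  shows "subgroup (centralizer G X) G"
proof
  show "centralizer G X \<subseteq> carrier G"
    by (auto simp: centralizer_def)
  show "\<one> \<in> centralizer G X"
    using assms by (auto simp: centralizer_def)
next
  fix g h assume "g \<in> centralizer G X" "h \<in> centralizer G X"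
  then show "g \<otimes> h \<in> centralizer G X"
    using assms unfolding centralizer_def by (auto simp: subset_iff) (metis m_assoc)
next
  fix g assume g: "g \<in> centralizer G X"
  have "x \<otimes> inv g = inv g \<otimes> x" if "x \<in> X" for x
  proof -
    have x: "x \<in> carrier G" and gc: "g \<in> carrier G" and xg: "x \<otimes> g = g \<otimes> x"
      using that assms g by (auto simp: centralizer_def)
    show ?thesis
      using x gc xg by (metis inv_closed inv_solve_left inv_solve_right m_assoc m_closed)
  qed
  then show "inv g \<in> centralizer G X"
    using g by (auto simp: centralizer_def)
qed

lemma (in group) centralizer_generate:
  assumes "X \<subseteq> carrier G"
  shows "centralizer G (generate G X) = centralizer G X"
proof
  show "centralizer G (generate G X) \<subseteq> centralizer G X"
    by (auto simp: centralizer_def intro: generate.incl)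
next
  have CX: "centralizer G X \<subseteq> carrier G"
    by (auto simp: centralizer_def)
  have "X \<subseteq> centralizer G (centralizer G X)"
    using assms by (auto simp: centralizer_def)
  then have "generate G X \<subseteq> centralizer G (centralizer G X)"
    using generate_subgroup_incl subgroup_centralizer[OF CX] by blast
  then show "centralizer G X \<subseteq> centralizer G (generate G X)"
    by (fastforce simp: centralizer_def)
qed

lemma (in group) meet_centralizer:
  assumes "X \<subseteq> carrier G" "Y \<subseteq> carrier G"
  shows "centralizer_meet (centralizer G X) (centralizer G Y) =
         centralizer G (generate G (X \<union> Y))"
proof -
  have "centralizer G (generate G (X \<union> Y)) = centralizer G (X \<union> Y)"
    using assms by (intro centralizer_generate) auto
  then show ?thesis
    by (auto simp: centralizer_meet_def centralizer_def)
qed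

lemma induced_map_centralizer:
  assumes "group G" "group K" "centralizer_respecting G K \<phi>" "X \<subseteq> carrier G"
  shows "induced_map G \<phi> (centralizer G X) = centralizer K (\<phi> ` X)"
proof -
  interpret group_hom G K \<phi>
    using assms by (auto simp: group_hom_def group_hom_axioms_def
        centralizer_respecting_def epi_def)
  have "\<phi> ` centralizer G X = \<phi> ` centralizer G (generate G X)"
    using assms by (simp add: G.centralizer_generate)
  also have "\<dots> = centralizer K (\<phi> ` generate G X)"
    using assms G.generate_is_subgroup by (auto simp: centralizer_respecting_def)
  also have "\<dots> = centralizer K (generate K (\<phi> ` X))"
    using assms generate_img by simp
  also have "\<dots> = centralizer K (\<phi> ` X)"
    using assms by (intro H.centralizer_generate) auto
  finally show ?thesis
    using assms by (auto simp: induced_map_def centralizer_lattice_def)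
qed

end

(* Both conditions say that \<phi> reflects commutation: if \<phi> x and \<phi> y commute, then so do x and y.
   For (1) \<Longrightarrow> (2), if \<phi> x and \<phi> y commute then \<phi> y = \<phi> c for some c that centralizes x, and y
   differs from c by an element of the kernel, which is central. If \<phi> reflects commutation, then
   every centralizer is a full preimage under \<phi>, so taking images is injective on centralizers
   and preserves intersections. *)
theory Submission
  imports Defs
begin

text \<open>With this convention the commutator is the quotient of \<open>x \<otimes> y\<close> by
  \<open>y \<otimes> x\<close>, because
  \<open>inv (y \<otimes> x) = inv x \<otimes> inv y\<close>.\<close>

lemma (in group) commutator_eq_one_iff:
  assumes "x \<in> carrier G" "y \<in> carrier G"
  shows "commutator G x y = \<one> \<longleftrightarrow> x \<otimes> y = y \<otimes> x"
proof -
  have "commutator G x y = (x \<otimes> y) \<otimes> inv (y \<otimes> x)"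
    using assms by (simp add: commutator_def inv_mult_group m_assoc)
  also have "\<dots> = \<one> \<longleftrightarrow> x \<otimes> y = y \<otimes> x"
    using assms inv_solve_right[of \<one> "x \<otimes> y" "y \<otimes> x"] by auto
  finally show ?thesis .
qed

lemma (in group_hom) hom_commutator:
  assumes "x \<in> carrier G" "y \<in> carrier G"
  shows "h (commutator G x y) = commutator H (h x) (h y)"
  using assms by (simp add: commutator_def)

text \<open>Translates condition (2) into reflection of commutation: \<open>h\<close> sends a
  commutator to the commutator of the images, which is trivial exactly when the images
  commute.\<close>

lemma (in group_hom) no_commutator_in_kernel_iff:
  "\<not> (\<exists>x\<in>carrier G. \<exists>y\<in>carrier G.
        commutator G x y \<noteq> \<one> \<and> commutator G x y \<in> kernel G H h) \<longleftrightarrow>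
   (\<forall>x\<in>carrier G. \<forall>y\<in>carrier G. h x \<otimes>\<^bsub>H\<^esub> h y = h y \<otimes>\<^bsub>H\<^esub> h x \<longrightarrow> x \<otimes> y = y \<otimes> x)"
proof -
  have "commutator G x y \<noteq> \<one> \<and> commutator G x y \<in> kernel G H h \<longleftrightarrow>
        x \<otimes> y \<noteq> y \<otimes> x \<and> h x \<otimes>\<^bsub>H\<^esub> h y = h y \<otimes>\<^bsub>H\<^esub> h x"
    if xy: "x \<in> carrier G" "y \<in> carrier G" for x y
  proof -
    have "commutator G x y \<in> carrier G"
      using xy by (simp add: commutator_def)
    then have "commutator G x y \<in> kernel G H h \<longleftrightarrow> commutator H (h x) (h y) = \<one>\<^bsub>H\<^esub>"
      using xy by (simp add: kernel_def hom_commutator)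
    then show ?thesis
      using xy by (simp only: G.commutator_eq_one_iff H.commutator_eq_one_iff hom_closed)
  qed
  then have "(\<exists>x\<in>carrier G. \<exists>y\<in>carrier G.
        commutator G x y \<noteq> \<one> \<and> commutator G x y \<in> kernel G H h) \<longleftrightarrow>
      (\<exists>x\<in>carrier G. \<exists>y\<in>carrier G.
        x \<otimes> y \<noteq> y \<otimes> x \<and> h x \<otimes>\<^bsub>H\<^esub> h y = h y \<otimes>\<^bsub>H\<^esub> h x)"
    by (intro bex_cong refl)
  then show ?thesis
    by auto
qed

lemma (in group_hom) centralizer_respecting_reflects_commute:
  assumes resp: "centralizer_respecting G H h"
    and ker: "kernel G H h \<subseteq> center G"
    and x: "x \<in> carrier G" and y: "y \<in> carrier G"
    and comm: "h x \<otimes>\<^bsub>H\<^esub> h y = h y \<otimes>\<^bsub>H\<^esub> h x"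
  shows "x \<otimes> y = y \<otimes> x"
proof -
  have X: "{x} \<subseteq> carrier G"
    using x by simp
  then have "centralizer G {x} \<in> centralizer_lattice G"
    unfolding centralizer_lattice_def by blast
  then have "h ` centralizer G {x} = centralizer H {h x}"
    \<comment> \<open>\<open>resp\<close> speaks only of subgroups, and \<open>{x}\<close> need not
      be one. \<open>induced_map_centralizer\<close> bridges the gap by passing to the subgroup
      generated by \<open>{x}\<close>, which has the same centralizer.\<close>
    using induced_map_centralizer[OF G.is_group H.is_group resp X] by (simp add: induced_map_def)
  moreover have "h y \<in> centralizer H {h x}"
    using comm y by (simp add: centralizer_def)
  ultimately obtain c where c: "c \<in> centralizer G {x}" and hc: "h y = h c"
    by (metis imageE)
  have cG: "c \<in> carrier G"
    using c by (simp add: centralizer_def)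
  have "y \<otimes> inv c \<in> kernel G H h"
    using y cG hc by (simp add: kernel_def)
  then have "y \<otimes> inv c \<in> center G"
    using ker by blast
  then have "y \<otimes> inv c \<in> centralizer G {x}"
    using x by (simp add: center_def centralizer_def)
  \<comment> \<open>Both factors commute with \<open>x\<close>: the first is central, and
    \<open>c\<close> was chosen in the centralizer. Their product is \<open>y\<close>.\<close>
  then have "(y \<otimes> inv c) \<otimes> c \<in> centralizer G {x}"
    using c by (rule subgroup.m_closed[OF G.subgroup_centralizer[OF X]])
  moreover have "(y \<otimes> inv c) \<otimes> c = y"
    using y cG by (simp add: G.m_assoc)
  ultimately show ?thesis
    by (simp add: centralizer_def)
qed

locale commute_reflecting_epi = group_hom G H h
  for G :: "('a, 'm) monoid_scheme" (structure) and H :: "('b, 'n) monoid_scheme" and h +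
  assumes surj: "h ` carrier G = carrier H"
    and reflect: "\<lbrakk>x \<in> carrier G; y \<in> carrier G; h x \<otimes>\<^bsub>H\<^esub> h y = h y \<otimes>\<^bsub>H\<^esub> h x\<rbrakk>
                  \<Longrightarrow> x \<otimes> y = y \<otimes> x"
begin

lemma hom_in_centralizer_iff:
  assumes "X \<subseteq> carrier G" "g \<in> carrier G"
  shows "h g \<in> centralizer H (h ` X) \<longleftrightarrow> g \<in> centralizer G X"
proof
  assume "h g \<in> centralizer H (h ` X)"
  then show "g \<in> centralizer G X"
    using assms reflect by (auto simp: centralizer_def subset_iff)
next
  assume g: "g \<in> centralizer G X"
  have "h x \<otimes>\<^bsub>H\<^esub> h g = h g \<otimes>\<^bsub>H\<^esub> h x" if "x \<in> X" for x
  proof -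
    have "h (x \<otimes> g) = h (g \<otimes> x)"
      using g that by (simp add: centralizer_def)
    then show ?thesis
      using assms that by (simp add: subset_iff)
  qed
  then show "h g \<in> centralizer H (h ` X)"
    using assms by (auto simp: centralizer_def)
qed

text \<open>By surjectivity each element of the right-hand side has a preimage, and any preimage
  centralizes \<open>X\<close>. Since \<open>X\<close> is an arbitrary subset, this also applies to
  generating sets of lattice elements.\<close>

lemma image_centralizer:
  assumes "X \<subseteq> carrier G"
  shows "h ` centralizer G X = centralizer H (h ` X)"
proof
  show "h ` centralizer G X \<subseteq> centralizer H (h ` X)"
    using hom_in_centralizer_iff[OF assms] by (auto simp: centralizer_def)
  show "centralizer H (h ` X) \<subseteq> h ` centralizer G X"
  proof
    fix k assume k: "k \<in> centralizer H (h ` X)"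
    then obtain g where "g \<in> carrier G" "k = h g"
      using surj by (auto simp: centralizer_def)
    then show "k \<in> h ` centralizer G X"
      using k hom_in_centralizer_iff[OF assms] by blast
  qed
qed

lemma centralizer_respecting: "centralizer_respecting G H h"
  using surj homh by (simp add: centralizer_respecting_def epi_def image_centralizer subgroup.subset)

text \<open>Lattice elements are saturated: they are unions of cosets of the kernel.\<close>

lemma hom_in_image_iff:
  assumes "A \<in> centralizer_lattice G" "g \<in> carrier G"
  shows "h g \<in> h ` A \<longleftrightarrow> g \<in> A"
  using assms image_centralizer hom_in_centralizer_iff by (auto simp: centralizer_lattice_def)

text \<open>If \<open>h a = h b\<close> with \<open>a\<close> in \<open>A\<close> and
  \<open>b\<close> in \<open>B\<close>, saturation of \<open>B\<close> puts \<open>a\<close> itself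
  into \<open>B\<close>.\<close>

lemma image_Int:
  assumes "A \<in> centralizer_lattice G" "B \<in> centralizer_lattice G"
  shows "h ` (A \<inter> B) = h ` A \<inter> h ` B"
proof -
  have "A \<subseteq> carrier G"
    using assms by (auto simp: centralizer_lattice_def centralizer_def)
  then show ?thesis
    using hom_in_image_iff[OF assms(2)] by blast
qed

lemma centralizer_lattice_iso: "centralizer_lattice_iso G H (induced_map G h)"
proof -
  have sub: "A \<subseteq> carrier G" if "A \<in> centralizer_lattice G" for A
    using that by (auto simp: centralizer_lattice_def centralizer_def)
  have cent: "centralizer G X \<in> centralizer_lattice G" if "X \<subseteq> carrier G" for X
    using that by (auto simp: centralizer_lattice_def)
  \<comment> \<open>\<open>induced_map\<close> is a restricted function, so it can be unfolded at a
    meet only once the meet is known to lie in the lattice.\<close>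
  have meet: "A \<inter> B \<in> centralizer_lattice G"
    if A: "A \<in> centralizer_lattice G" and B: "B \<in> centralizer_lattice G" for A B
  proof -
    obtain X Y where "X \<subseteq> carrier G" "Y \<subseteq> carrier G" "A = centralizer G X" "B = centralizer G Y"
      using A B by (auto simp: centralizer_lattice_def)
    then have "A \<inter> B = centralizer G (X \<union> Y)" and "X \<union> Y \<subseteq> carrier G"
      by (auto simp: centralizer_def)
    then show ?thesis
      using cent by simp
  qed
  have ind: "induced_map G h A = h ` A" if "A \<in> centralizer_lattice G" for A
    using that by (simp add: induced_map_def)
  have closed: "induced_map G h \<in> centralizer_lattice G \<rightarrow> centralizer_lattice H"
  proof
    fix A assume A: "A \<in> centralizer_lattice G"
    then obtain X where X: "X \<subseteq> carrier G" "A = centralizer G X"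
      by (auto simp: centralizer_lattice_def)
    have "h ` X \<subseteq> carrier H"
      using X by auto
    then show "induced_map G h A \<in> centralizer_lattice H"
      using X image_centralizer ind[OF A] by (auto simp: centralizer_lattice_def)
  qed
  have meets: "induced_map G h (centralizer_meet A B)
      = centralizer_meet (induced_map G h A) (induced_map G h B)"
    if "A \<in> centralizer_lattice G" "B \<in> centralizer_lattice G" for A B
    using that by (simp add: centralizer_meet_def ind meet image_Int)
  have joins: "induced_map G h (centralizer_join G A B)
      = centralizer_join H (induced_map G h A) (induced_map G h B)"
    if A: "A \<in> centralizer_lattice G" and B: "B \<in> centralizer_lattice G" for A B
  proof -
    let ?M = "centralizer G A \<inter> centralizer G B"
    have M: "?M \<subseteq> carrier G"
      by (auto simp: centralizer_def)
    \<comment> \<open>A join is a centralizer of an intersection of centralizers, so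
      \<open>h\<close> is pushed inwards through the three layers in turn.\<close>
    have "h ` centralizer G ?M = centralizer H (h ` ?M)"
      by (rule image_centralizer[OF M])
    also have "h ` ?M = centralizer H (h ` A) \<inter> centralizer H (h ` B)"
      using A B by (simp add: image_Int image_centralizer sub cent)
    finally show ?thesis
      using A B by (simp add: centralizer_join_def centralizer_meet_def ind cent M)
  qed
  have invol: "induced_map G h (centralizer G (centralizer G X))
      = centralizer H (induced_map G h (centralizer G X))" if "subgroup X G" for X
    using subgroup.subset[OF that] by (simp add: ind cent sub image_centralizer)
  have "inj_on (induced_map G h) (centralizer_lattice G)"
  proof (rule inj_onI)
    fix A B
    assume A: "A \<in> centralizer_lattice G" and B: "B \<in> centralizer_lattice G"
      and "induced_map G h A = induced_map G h B"
    then have "h ` A = h ` B"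
      by (simp add: ind)
    then show "A = B"
      \<comment> \<open>Each of \<open>A\<close> and \<open>B\<close> is recovered as the preimage
        in \<open>carrier G\<close> of the common image.\<close>
      using hom_in_image_iff[OF A] hom_in_image_iff[OF B] sub[OF A] sub[OF B] by blast
  qed
  moreover have "centralizer_lattice H \<subseteq> induced_map G h ` centralizer_lattice G"
  proof
    fix C assume "C \<in> centralizer_lattice H"
    then obtain Y where Y: "Y \<subseteq> carrier H" "C = centralizer H Y"
      by (auto simp: centralizer_lattice_def)
    \<comment> \<open>Any lift \<open>X\<close> of the set \<open>Y\<close> will do, since
      \<open>image_centralizer\<close> depends on \<open>X\<close> only through its image on the
      right-hand side.\<close>
    then obtain X where X: "X \<subseteq> carrier G" "Y = h ` X"
      using surj by (metis subset_image_iff)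
    then have "C = induced_map G h (centralizer G X)"
      using Y by (simp add: ind cent image_centralizer)
    then show "C \<in> induced_map G h ` centralizer_lattice G"
      using cent[OF X(1)] by (rule image_eqI)
  qed
  ultimately have "bij_betw (induced_map G h) (centralizer_lattice G) (centralizer_lattice H)"
    using closed by (auto simp: bij_betw_def)
  then show ?thesis
    using closed meets joins invol
    by (simp add: centralizer_lattice_iso_def centralizer_lattice_hom_def)
qed

end

theorem theorem3:
  fixes G :: "('a, 'm) monoid_scheme" and K :: "('b, 'n) monoid_scheme" and \<phi> :: "'a \<Rightarrow> 'b"
  assumes "group G" and "group K"
    and "\<phi> \<in> epi G K"
    and "kernel G K \<phi> \<subseteq> center G"
  shows "(centralizer_respecting G K \<phi> \<longleftrightarrow>
            \<not> (\<exists>x\<in>carrier G. \<exists>y\<in>carrier G.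
                 commutator G x y \<noteq> \<one>\<^bsub>G\<^esub> \<and> commutator G x y \<in> kernel G K \<phi>)) \<and>
         (centralizer_respecting G K \<phi> \<longrightarrow>
            centralizer_lattice_iso G K (induced_map G \<phi>))"
proof -
  interpret group_hom G K \<phi>
    using assms by (auto simp: group_hom_def group_hom_axioms_def epi_def)
  let ?reflects = "\<forall>x\<in>carrier G. \<forall>y\<in>carrier G.
      \<phi> x \<otimes>\<^bsub>K\<^esub> \<phi> y = \<phi> y \<otimes>\<^bsub>K\<^esub> \<phi> x \<longrightarrow> x \<otimes>\<^bsub>G\<^esub> y = y \<otimes>\<^bsub>G\<^esub> x"
  have reflects: ?reflects if "centralizer_respecting G K \<phi>"
    using centralizer_respecting_reflects_commute[OF that assms(4)] by blast
  have loc: "commute_reflecting_epi G K \<phi>" if ?reflects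
    using that assms(3) by unfold_locales (auto simp: epi_def)
  have "centralizer_respecting G K \<phi> \<longleftrightarrow> ?reflects"
    using reflects commute_reflecting_epi.centralizer_respecting[OF loc] by blast
  moreover have "centralizer_lattice_iso G K (induced_map G \<phi>)" if "centralizer_respecting G K \<phi>"
    \<comment> \<open>Condition (1) yields reflection of commutation, which places
      \<open>\<phi>\<close> in the locale where the isomorphism was proved.\<close>
    using commute_reflecting_epi.centralizer_lattice_iso[OF loc[OF reflects[OF that]]] .
  ultimately show ?thesis
    unfolding no_commutator_in_kernel_iff by blast
qed

end
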